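(* Let $G$ and $H$ be connected graphs such that $H\neq K_2$ and $\mathrm{Aut}(G[H])=\mathrm{Aut}(G)[\mathrm{Aut}(H)]$. Then $$D'(G[H])\leq \max\{D'(G),D'(H)\}.$$
   Context: All graphs are finite and simple. For a graph $X$, an edge labeling $\psi:E(X)\to\{1,\dots,d\}$ is distinguishing if the only automorphism of $X$ preserving all edge labels is the identity; the distinguishing index $D'(X)$ is the least $d$ such that $X$ has a distinguishing edge labeling with $d$ labels. The lexicographic product $G[H]$ has vertex set $V(G)\times V(H)$, with $(a,x)$ adjacent to $(b,y)$ iff $ab\in E(G)$, or $a=b$ and $xy\in E(H)$. The wreath product $\mathrm{Aut}(G)[\mathrm{Aut}(H)]$ is the subgroup of $\mathrm{Aut}(G[H])$ consisting of all maps $(g,h)\mapsto(\alpha g,\beta_g h)$ with $\alpha\in\mathrm{Aut}(G)$ and $\beta_g\in\mathrm{Aut}(H)$ for each $g\in V(G)$. *)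

theory Defs
  imports Main "HOL-Library.Extended_Nat" "HOL-Library.FuncSet" "HOL-Combinatorics.Permutations"
begin

record 'a graph =
  verts :: "'a set"
  edges :: "'a set set"

definition finite_simple_graph :: "'a graph \<Rightarrow> bool" where
  "finite_simple_graph X \<longleftrightarrow>
     finite (verts X) \<and> (\<forall>e\<in>edges X. e \<subseteq> verts X \<and> card e = 2)"

definition adjacent :: "'a graph \<Rightarrow> 'a \<Rightarrow> 'a \<Rightarrow> bool" where
  "adjacent X u v \<longleftrightarrow> {u, v} \<in> edges X"

text \<open>The graph without vertices does not count as connected; the one-vertex graph does.\<close>

definition connected_graph :: "'a graph \<Rightarrow> bool" where
  "connected_graph X \<longleftrightarrow>
     verts X \<noteq> {} \<and> (\<forall>u\<in>verts X. \<forall>v\<in>verts X. (adjacent X)\<^sup>*\<^sup>* u v)"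

definition graph_isomorphism :: "'a graph \<Rightarrow> 'b graph \<Rightarrow> ('a \<Rightarrow> 'b) \<Rightarrow> bool" where
  "graph_isomorphism X Y f \<longleftrightarrow>
     bij_betw f (verts X) (verts Y) \<and>
     (\<forall>u\<in>verts X. \<forall>v\<in>verts X. adjacent Y (f u) (f v) \<longleftrightarrow> adjacent X u v)"

definition isomorphic :: "'a graph \<Rightarrow> 'b graph \<Rightarrow> bool" where
  "isomorphic X Y \<longleftrightarrow> (\<exists>f. graph_isomorphism X Y f)"

definition complete_graph :: "nat \<Rightarrow> nat graph" where
  "complete_graph n = \<lparr>verts = {..<n}, edges = {e. e \<subseteq> {..<n} \<and> card e = 2}\<rparr>"

text \<open>Automorphisms are total functions fixing everything outside the vertex set, so that
  each automorphism has exactly one representative, and the identity is \<open>id\<close>.\<close>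

definition Aut :: "'a graph \<Rightarrow> ('a \<Rightarrow> 'a) set" where
  "Aut X = {f. f permutes verts X \<and> graph_isomorphism X X f}"

definition distinguishing_edge_labeling :: "'a graph \<Rightarrow> nat \<Rightarrow> ('a set \<Rightarrow> nat) \<Rightarrow> bool" where
  "distinguishing_edge_labeling X d \<psi> \<longleftrightarrow>
     \<psi> \<in> edges X \<rightarrow> {1..d} \<and>
     (\<forall>f\<in>Aut X. (\<forall>e\<in>edges X. \<psi> (f ` e) = \<psi> e) \<longrightarrow> f = id)"

text \<open>The value is \<open>\<infinity>\<close> if there is no distinguishing edge labeling at all, as for the complete
  graph on two vertices. The condition \<open>1 \<le> d\<close> matters only for the one-vertex graph, whose
  index is thereby 1.\<close>

definition distinguishing_index :: "'a graph \<Rightarrow> enat" where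
  "distinguishing_index X =
     Inf {enat d | d. 1 \<le> d \<and> (\<exists>\<psi>. distinguishing_edge_labeling X d \<psi>)}"

definition lex_product :: "'a graph \<Rightarrow> 'b graph \<Rightarrow> ('a \<times> 'b) graph" where
  "lex_product G H =
     \<lparr>verts = verts G \<times> verts H,
      edges = {{(a, x), (b, y)} | a b x y.
         a \<in> verts G \<and> b \<in> verts G \<and> x \<in> verts H \<and> y \<in> verts H \<and>
         (adjacent G a b \<or> (a = b \<and> adjacent H x y))}\<rparr>"

text \<open>The wreath product \<open>A[B]\<close> of groups \<open>A\<close> and \<open>B\<close> of permutations of \<open>V\<close> and \<open>W\<close>; its
  elements again fix everything outside \<open>V \<times> W\<close>.\<close>

definition wreath_product ::
    "'a set \<Rightarrow> ('a \<Rightarrow> 'a) set \<Rightarrow> 'b set \<Rightarrow> ('b \<Rightarrow> 'b) set \<Rightarrow> ('a \<times> 'b \<Rightarrow> 'a \<times> 'b) set" where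
  "wreath_product V A W B =
     {(\<lambda>(g, h). if g \<in> V \<and> h \<in> W then (\<alpha> g, \<beta> g h) else (g, h)) | \<alpha> \<beta>.
        \<alpha> \<in> A \<and> (\<forall>g\<in>V. \<beta> g \<in> B)}"

end

theory Submission imports Defs begin

text \<open>Label an edge between different copies of \<open>H\<close> like the edge of \<open>G\<close> below it, and label every
  copy of \<open>H\<close> by a distinguishing labeling of \<open>H\<close>. If \<open>(g, h) \<mapsto> (\<alpha> g, \<beta> g h)\<close> preserves these
  labels, then \<open>\<alpha>\<close> preserves the labels of \<open>G\<close>, so \<open>\<alpha> = id\<close>; hence every copy of \<open>H\<close> is mapped to
  itself and every \<open>\<beta> g\<close> preserves the labels of \<open>H\<close>.\<close>

lemma distinguishing_edge_labeling_mono: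
  assumes "distinguishing_edge_labeling X d \<psi>" and "d \<le> d'"
  shows "distinguishing_edge_labeling X d' \<psi>"
  using assms unfolding distinguishing_edge_labeling_def by (fastforce simp: Pi_iff)

text \<open>\<open>enat\<close> is well-ordered, so an infimum over a nonempty set is attained, and
  an attained value below \<open>d\<close> may be raised to \<open>d\<close> by monotonicity. This
  turns bounds on the index into labelings and back.\<close>

lemma distinguishing_index_le_iff:
  "distinguishing_index X \<le> enat d \<longleftrightarrow>
     1 \<le> d \<and> (\<exists>\<psi>. distinguishing_edge_labeling X d \<psi>)"
proof
  let ?S = "{enat d | d. 1 \<le> d \<and> (\<exists>\<psi>. distinguishing_edge_labeling X d \<psi>)}"
  assume le: "distinguishing_index X \<le> enat d"
  have "?S \<noteq> {}"
  proof
    \<comment> \<open>The infimum of the empty set is \<infinity>, which is not below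
      \<open>enat d\<close>.\<close>
    assume "?S = {}"
    then show False
      using le unfolding distinguishing_index_def by (simp only: Inf_enat_def) simp
  qed
  then obtain k where "k \<in> ?S"
    by blast
  then have "Inf ?S \<in> ?S"
    by (rule wellorder_InfI)
  then obtain d' \<psi> where "Inf ?S = enat d'" "1 \<le> d'" "distinguishing_edge_labeling X d' \<psi>"
    by blast
  moreover from this have "d' \<le> d"
    using le unfolding distinguishing_index_def by simp
  ultimately show "1 \<le> d \<and> (\<exists>\<psi>. distinguishing_edge_labeling X d \<psi>)"
    using distinguishing_edge_labeling_mono le_trans by blast
next
  assume "1 \<le> d \<and> (\<exists>\<psi>. distinguishing_edge_labeling X d \<psi>)"
  then show "distinguishing_index X \<le> enat d"
    unfolding distinguishing_index_def by (intro Inf_lower) auto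
qed

lemma edge_obtain:
  assumes "finite_simple_graph X" and "e \<in> edges X"
  obtains u v where "e = {u, v}" "u \<noteq> v" "u \<in> verts X" "v \<in> verts X" "adjacent X u v"
proof -
  have "e \<subseteq> verts X" "card e = 2"
    using assms unfolding finite_simple_graph_def by auto
  then show ?thesis
    using assms(2) that unfolding adjacent_def by (auto simp: card_2_iff)
qed

lemma not_adjacent_self:
  assumes "finite_simple_graph X"
  shows "\<not> adjacent X u u"
  using assms unfolding finite_simple_graph_def adjacent_def by fastforce

lemma Aut_adjacent_iff:
  assumes "f \<in> Aut X" "u \<in> verts X" "v \<in> verts X"
  shows "adjacent X (f u) (f v) \<longleftrightarrow> adjacent X u v"
  using assms unfolding Aut_def graph_isomorphism_def by blast

lemma lex_product_edgeI:
  assumes "a \<in> verts G" "b \<in> verts G" "x \<in> verts H" "y \<in> verts H"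
    and "adjacent G a b \<or> a = b \<and> adjacent H x y"
  shows "{(a, x), (b, y)} \<in> edges (lex_product G H)"
  using assms unfolding lex_product_def by auto

text \<open>Projecting the whole edge makes the value independent of the order of its ends. An edge
  inside a copy of \<open>H\<close> projects under \<open>fst\<close> to a singleton, which is no
  edge of a simple graph, so the test separates the two kinds of edges.\<close>

definition lex_labeling ::
    "'a graph \<Rightarrow> ('a set \<Rightarrow> nat) \<Rightarrow> ('b set \<Rightarrow> nat) \<Rightarrow> ('a \<times> 'b) set \<Rightarrow> nat" where
  "lex_labeling G \<psi>G \<psi>H e = (if fst ` e \<in> edges G then \<psi>G (fst ` e) else \<psi>H (snd ` e))"

lemma lex_labeling_between:
  assumes "adjacent G a b"
  shows "lex_labeling G \<psi>G \<psi>H {(a, x), (b, y)} = \<psi>G {a, b}"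
  using assms by (simp add: lex_labeling_def adjacent_def)

lemma lex_labeling_within:
  assumes "finite_simple_graph G"
  shows "lex_labeling G \<psi>G \<psi>H {(a, x), (a, y)} = \<psi>H {x, y}"
  using not_adjacent_self[OF assms, of a] by (simp add: lex_labeling_def adjacent_def)

text \<open>Both kinds of edges can share the same \<open>d\<close> labels: every map in the wreath
  product sends edges between copies to edges between copies and edges inside copies to edges inside
  copies, so the labels need not tell the two kinds apart.\<close>

lemma distinguishing_lex_labeling:
  fixes G :: "'a graph" and H :: "'b graph"
  assumes G: "finite_simple_graph G" and H: "finite_simple_graph H" and ne: "verts H \<noteq> {}"
    and Aut: "Aut (lex_product G H) \<subseteq> wreath_product (verts G) (Aut G) (verts H) (Aut H)"
    and \<psi>G: "distinguishing_edge_labeling G d \<psi>G"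
    and \<psi>H: "distinguishing_edge_labeling H d \<psi>H"
  shows "distinguishing_edge_labeling (lex_product G H) d (lex_labeling G \<psi>G \<psi>H)"
proof -
  let ?\<psi> = "lex_labeling G \<psi>G \<psi>H"
  have "?\<psi> e \<in> {1..d}" if e: "e \<in> edges (lex_product G H)" for e
  proof -
    obtain a b x y where "e = {(a, x), (b, y)}" and "adjacent G a b \<or> a = b \<and> adjacent H x y"
      using e unfolding lex_product_def by auto
    moreover have "\<psi>G \<in> edges G \<rightarrow> {1..d}" "\<psi>H \<in> edges H \<rightarrow> {1..d}"
      using \<psi>G \<psi>H unfolding distinguishing_edge_labeling_def by auto
    ultimately show ?thesis
      by (auto simp: lex_labeling_between lex_labeling_within[OF G] adjacent_def Pi_iff
          simp del: atLeastAtMost_iff)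
  qed
  moreover have "f = id"
    if f: "f \<in> Aut (lex_product G H)"
      and pres: "\<forall>e\<in>edges (lex_product G H). ?\<psi> (f ` e) = ?\<psi> e" for f
  proof -
    obtain \<alpha> \<beta>
      where f_eq: "f = (\<lambda>(g, h). if g \<in> verts G \<and> h \<in> verts H then (\<alpha> g, \<beta> g h) else (g, h))"
        and \<alpha>: "\<alpha> \<in> Aut G" and \<beta>: "\<And>g. g \<in> verts G \<Longrightarrow> \<beta> g \<in> Aut H"
      using f Aut unfolding wreath_product_def by blast
    obtain x where x: "x \<in> verts H"
      using ne by blast
    have "\<psi>G (\<alpha> ` e) = \<psi>G e" if e: "e \<in> edges G" for e
    proof -
      obtain a b where ab: "e = {a, b}" "a \<in> verts G" "b \<in> verts G" "adjacent G a b"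
        using edge_obtain[OF G e] by metis
      \<comment> \<open>The edge of \<open>G\<close> is lifted to the layer of the fixed vertex
        \<open>x\<close>. Its image may leave every layer, since \<open>\<beta> a x\<close> and
        \<open>\<beta> b x\<close> can differ, but the label of an edge between copies ignores
        second coordinates.\<close>
      have "?\<psi> (f ` {(a, x), (b, x)}) = ?\<psi> {(a, x), (b, x)}"
        using ab x by (intro bspec[OF pres] lex_product_edgeI) auto
      moreover have "f ` {(a, x), (b, x)} = {(\<alpha> a, \<beta> a x), (\<alpha> b, \<beta> b x)}"
        using ab x by (simp add: f_eq)
      moreover have "adjacent G (\<alpha> a) (\<alpha> b)"
        using Aut_adjacent_iff[OF \<alpha>] ab by blast
      ultimately show ?thesis
        using ab by (simp add: lex_labeling_between)
    qed
    then have \<alpha>_id: "\<alpha> = id"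
      using \<alpha> \<psi>G unfolding distinguishing_edge_labeling_def by blast
    have \<beta>_id: "\<beta> g = id" if g: "g \<in> verts G" for g
    proof -
      have "\<psi>H (\<beta> g ` e) = \<psi>H e" if e: "e \<in> edges H" for e
      proof -
        obtain u v where uv: "e = {u, v}" "u \<in> verts H" "v \<in> verts H" "adjacent H u v"
          using edge_obtain[OF H e] by metis
        have "?\<psi> (f ` {(g, u), (g, v)}) = ?\<psi> {(g, u), (g, v)}"
          using g uv by (intro bspec[OF pres] lex_product_edgeI) auto
        \<comment> \<open>As \<open>\<alpha>\<close> is the identity, the image lies in the same
          copy of \<open>H\<close>, where labels are those of \<open>\<psi>H\<close>.\<close>
        moreover have "f ` {(g, u), (g, v)} = {(g, \<beta> g u), (g, \<beta> g v)}"
          using g uv by (simp add: f_eq \<alpha>_id)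
        ultimately show ?thesis
          using uv by (simp add: lex_labeling_within[OF G])
      qed
      then show ?thesis
        using \<beta>[OF g] \<psi>H unfolding distinguishing_edge_labeling_def by blast
    qed
    show ?thesis
      by (auto simp: f_eq \<alpha>_id \<beta>_id fun_eq_iff)
  qed
  ultimately show ?thesis
    unfolding distinguishing_edge_labeling_def by blast
qed

theorem theorem3p1:
  fixes G :: "'a graph" and H :: "'b graph"
  assumes "finite_simple_graph G" and "finite_simple_graph H"
    and "connected_graph G" and "connected_graph H"
    and "\<not> isomorphic H (complete_graph 2)"
    and "Aut (lex_product G H) = wreath_product (verts G) (Aut G) (verts H) (Aut H)"
  shows "distinguishing_index (lex_product G H)
           \<le> max (distinguishing_index G) (distinguishing_index H)"
proof (cases "max (distinguishing_index G) (distinguishing_index H)")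
  \<comment> \<open>A finite maximum \<open>d\<close> serves as a common number of labels for both
    graphs; an infinite one makes the bound trivial.\<close>
  case (enat d)
  then have "distinguishing_index G \<le> enat d" "distinguishing_index H \<le> enat d"
    by (metis max.cobounded1, metis max.cobounded2)
  then obtain \<psi>G \<psi>H where "1 \<le> d" "distinguishing_edge_labeling G d \<psi>G"
    "distinguishing_edge_labeling H d \<psi>H"
    unfolding distinguishing_index_le_iff by blast
  moreover have "verts H \<noteq> {}"
    using assms(4) unfolding connected_graph_def by blast
  ultimately show ?thesis
    using distinguishing_lex_labeling[OF assms(1,2)] assms(6)
    unfolding enat distinguishing_index_le_iff by blast
qed simp

end
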